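(* Let $s:[1,\infty)\to\mathbb{C}$ be a function with $s\in L_{\rm loc}[1,\infty)$ that is slowly oscillating with respect to summability $(L,1)$. If $s$ is summable $(L,1)$ to some $A\in\mathbb{C}$, then the ordinary limit $\lim_{t\to\infty}s(t)=A$ also exists.
   Context: $L_{\rm loc}[1,\infty)$ denotes the set of functions on $[1,\infty)$ that are Lebesgue integrable on every bounded interval $[1,t]$, $t>1$. A function $s\in L_{\rm loc}[1,\infty)$ is called summable $(L,1)$ to $A$ if $\lim_{t\to\infty}\tau(t)=A$, where $\tau(t):=\frac{1}{\log t}\int_1^t\frac{s(u)}{u}\,du$ for $t>1$, with $\log$ the natural logarithm. A function $s:[1,\infty)\to\mathbb{C}$ is called slowly oscillating with respect to summability $(L,1)$ if for every $\varepsilon>0$ there exist $t_0=t_0(\varepsilon)>1$ and $\lambda=\lambda(\varepsilon)>1$ such that $|s(u)-s(t)|\le\varepsilon$ whenever $t_0\le t<u\le t^\lambda$. *)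

theory Defs
  imports "HOL-Analysis.Analysis"
begin

(* Functions on [1,\<infinity>) are represented by total functions on the reals; none of the
   notions below depends on the values to the left of 1. *)

definition L_loc :: "(real \<Rightarrow> complex) set" where
  "L_loc = {s. \<forall>t>1. set_integrable lebesgue {1..t} s}"

definition log_mean :: "(real \<Rightarrow> complex) \<Rightarrow> real \<Rightarrow> complex" where
  "log_mean s t = (1 / of_real (ln t)) * (LINT u:{1..t}|lebesgue. s u / of_real u)"

definition summable_L1 :: "(real \<Rightarrow> complex) \<Rightarrow> complex \<Rightarrow> bool" where
  "summable_L1 s A \<longleftrightarrow> s \<in> L_loc \<and> (log_mean s \<longlongrightarrow> A) at_top"

definition slowly_oscillating_L1 :: "(real \<Rightarrow> complex) \<Rightarrow> bool" where
  "slowly_oscillating_L1 s \<longleftrightarrow>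
     (\<forall>\<epsilon>>0. \<exists>t0>1. \<exists>l>1. \<forall>t u. t0 \<le> t \<and> t < u \<and> u \<le> t powr l \<longrightarrow> cmod (s u - s t) \<le> \<epsilon>)"

end

theory Submission
  imports Defs "HOL-Real_Asymp.Real_Asymp"
begin

text \<open>Slow oscillation makes \<open>s\<close> nearly constant on \<open>[t, t\<^sup>\<lambda>]\<close>, so
  \<open>s t\<close> is within \<open>\<epsilon>\<close> of its mean over that interval with weight \<open>1/u\<close>. This mean equals
  \<open>(\<lambda> \<tau>(t\<^sup>\<lambda>) - \<tau>(t)) / (\<lambda> - 1)\<close>, which tends to \<open>A\<close>.\<close>

lemma L_loc_over_id_integrable:
  assumes "s \<in> L_loc" "t > 1"
  shows "(\<lambda>u. s u / of_real u) absolutely_integrable_on {1..t}"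
proof -
  have s: "s absolutely_integrable_on {1..t}"
    using assms by (simp add: L_loc_def)
  \<comment> \<open>The weight is continuous and bounded by 1 on \<open>{1..t}\<close>; writing the
    quotient with \<open>scaleR\<close> makes it a bilinear product of a bounded measurable and an
    integrable function.\<close>
  have "(\<lambda>u. inverse u *\<^sub>R s u) absolutely_integrable_on {1..t}"
  proof (rule absolutely_integrable_bounded_measurable_product[where h = "(*\<^sub>R)" and f = inverse])
    show "bilinear ((*\<^sub>R) :: real \<Rightarrow> complex \<Rightarrow> complex)"
      by (simp add: bilinear_conv_bounded_bilinear bounded_bilinear_scaleR)
    show "inverse \<in> borel_measurable (lebesgue_on {1..t})"
      by (intro continuous_imp_measurable_on_sets_lebesgue continuous_intros) auto
    have "norm (inverse u) \<le> 1" if "u \<in> {1..t}" for u :: real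
      using that by (simp add: inverse_le_1_iff)
    then show "bounded (inverse ` {1..t})"
      unfolding bounded_iff by blast
  qed (use s in auto)
  then show ?thesis
    by (simp add: scaleR_conv_of_real divide_inverse mult.commute)
qed

text \<open>Passes from the Lebesgue integral to the gauge integral, where splitting at a point and
  the fundamental theorem of calculus are applied. Since \<open>t > 1\<close>, \<open>ln t\<close>
  is nonzero and cancels.\<close>

lemma log_mean_times_ln:
  assumes "s \<in> L_loc" "t > 1"
  shows "of_real (ln t) * log_mean s t = integral {1..t} (\<lambda>u. s u / of_real u)"
  using assms set_lebesgue_integral_eq_integral(2)[OF L_loc_over_id_integrable[OF assms]]
  by (simp add: log_mean_def)

text \<open>The weight \<open>1/u\<close> has total mass \<open>ln T - ln t\<close> on
  \<open>{t..T}\<close>, so the pointwise bound is integrated against it. Not dividing by this mass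
  keeps the case \<open>t = T\<close> valid.\<close>

lemma norm_diff_weighted_mean_le:
  fixes s :: "real \<Rightarrow> complex"
  assumes "0 < t" "t \<le> T"
    and int: "(\<lambda>u. s u / of_real u) integrable_on {t..T}"
    and bound: "\<And>u. u \<in> {t..T} \<Longrightarrow> cmod (s u - c) \<le> e"
  shows "cmod (integral {t..T} (\<lambda>u. s u / of_real u) - of_real (ln T - ln t) * c) \<le> e * (ln T - ln t)"
proof -
  have inv: "((\<lambda>u. inverse u) has_integral (ln T - ln t)) {t..T}"
    using assms(1,2)
    by (intro fundamental_theorem_of_calculus)
       (auto intro!: derivative_eq_intros simp: divide_inverse
         simp flip: has_real_derivative_iff_has_vector_derivative)
  have c: "((\<lambda>u. c / of_real u) has_integral of_real (ln T - ln t) * c) {t..T}"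
    using has_integral_scaleR_left[OF inv, of c]
    by (simp add: scaleR_conv_of_real divide_inverse mult.commute)
  have d: "((\<lambda>u. s u / of_real u - c / of_real u) has_integral
      integral {t..T} (\<lambda>u. s u / of_real u) - of_real (ln T - ln t) * c) {t..T}"
    by (intro has_integral_diff c integrable_integral int)
  have e: "((\<lambda>u. e * inverse u) has_integral e * (ln T - ln t)) {t..T}"
    by (intro has_integral_mult_right inv)
  have "cmod (s u / of_real u - c / of_real u) \<le> e * inverse u" if "u \<in> {t..T}" for u
  proof -
    have "s u / of_real u - c / of_real u = of_real (inverse u) * (s u - c)"
      by (simp add: divide_inverse algebra_simps)
    then have "cmod (s u / of_real u - c / of_real u) = cmod (s u - c) * inverse u"
      using that assms(1) by (simp only: norm_mult norm_of_real) simp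
    then show ?thesis
      using bound[OF that] that assms(1) by (simp add: mult_right_mono)
  qed
  then show ?thesis
    using integral_norm_bound_integral[OF has_integral_integrable[OF d] has_integral_integrable[OF e]]
    unfolding integral_unique[OF d] integral_unique[OF e] by blast
qed

text \<open>The quotient is the mean of \<open>s\<close> over \<open>{t..t powr l}\<close> with
  weight \<open>1/u\<close>, so it inherits the pointwise bound around \<open>s t\<close>.\<close>

lemma norm_diff_log_mean_le:
  assumes s: "s \<in> L_loc" and t: "1 < t" and l: "1 < l"
    and bound: "\<And>u. t < u \<Longrightarrow> u \<le> t powr l \<Longrightarrow> cmod (s u - s t) \<le> e" and e: "0 \<le> e"
  shows "cmod ((of_real l * log_mean s (t powr l) - log_mean s t) / of_real (l - 1) - s t) \<le> e"
    (is "cmod (?m - s t) \<le> e")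
proof -
  let ?f = "\<lambda>u. s u / of_real u"
  define T where "T = t powr l"
  have tT: "t < T"
    using powr_less_mono[OF l t] t by (simp add: T_def)
  have lnT: "ln T = l * ln t"
    using t by (simp add: T_def ln_powr)
  have int: "?f integrable_on {1..T}"
    using t tT by (intro set_lebesgue_integral_eq_integral(1) L_loc_over_id_integrable[OF s]) simp
  have int': "?f integrable_on {t..T}"
    by (rule integrable_on_subinterval[OF int]) (use t in auto)
  have "integral {t..T} ?f = integral {1..T} ?f - integral {1..t} ?f"
    using Henstock_Kurzweil_Integration.integral_combine[OF _ _ int, of t] t tT
    by (simp add: algebra_simps)
  also have "\<dots> = of_real (ln T) * log_mean s T - of_real (ln t) * log_mean s t"
    using t tT by (simp add: log_mean_times_ln[OF s])
  \<comment> \<open>Because \<open>ln T = l * ln t\<close>, the mass is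
    \<open>(l - 1) * ln t\<close>, and the coefficients in \<open>?m\<close> depend on
    \<open>l\<close> alone.\<close>
  also have "\<dots> = of_real (ln T - ln t) * ?m"
    using l by (simp add: lnT field_simps flip: T_def)
  finally have eq: "integral {t..T} ?f = of_real (ln T - ln t) * ?m" .
  have pos: "0 < ln T - ln t"
    using t tT by simp
  \<comment> \<open>The assumed bound covers only \<open>t < u\<close>; at \<open>u = t\<close> the
    difference vanishes and \<open>0 \<le> e\<close> suffices.\<close>
  have "cmod (s u - s t) \<le> e" if "u \<in> {t..T}" for u
    using that bound[of u] e by (cases "u = t") (auto simp: T_def)
  then have "cmod (integral {t..T} ?f - of_real (ln T - ln t) * s t) \<le> e * (ln T - ln t)"
    using norm_diff_weighted_mean_le[OF _ _ int'] t tT by simp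
  then have "(ln T - ln t) * cmod (?m - s t) \<le> (ln T - ln t) * e"
    unfolding eq right_diff_distrib[symmetric] norm_mult norm_of_real
    using pos by (simp add: mult.commute)
  then show ?thesis
    using pos by simp
qed

theorem corollary2:
  fixes s :: "real \<Rightarrow> complex" and A :: complex
  assumes "s \<in> L_loc"
    and "slowly_oscillating_L1 s"
    and "summable_L1 s A"
  shows "(s \<longlongrightarrow> A) at_top"
proof (rule tendstoI)
  fix e :: real assume "e > 0"
  \<comment> \<open>One half bounds the distance from \<open>s t\<close> to the mean
    \<open>m t\<close>, the other that from \<open>m t\<close> to \<open>A\<close>.\<close>
  then have e2: "e / 2 > 0" by simp
  obtain t0 l where t0: "t0 > 1" and l: "l > 1"
    and osc: "\<And>t u. t0 \<le> t \<Longrightarrow> t < u \<Longrightarrow> u \<le> t powr l \<Longrightarrow> cmod (s u - s t) \<le> e / 2"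
    using assms(2) e2 unfolding slowly_oscillating_L1_def by metis
  define m where "m t = (of_real l * log_mean s (t powr l) - log_mean s t) / of_real (l - 1)" for t
  have lim: "(log_mean s \<longlongrightarrow> A) at_top"
    using assms(3) by (simp add: summable_L1_def)
  have "filterlim (\<lambda>t. t powr l) at_top at_top"
    using l by real_asymp
  then have lim': "((\<lambda>t. log_mean s (t powr l)) \<longlongrightarrow> A) at_top"
    by (rule filterlim_compose[OF lim])
  \<comment> \<open>Here \<open>l\<close> depends on \<open>e\<close> but not on \<open>t\<close>,
    so \<open>m\<close> combines two functions tending to \<open>A\<close> with constant
    coefficients whose sum is 1.\<close>
  have "(m \<longlongrightarrow> (of_real l * A - A) / of_real (l - 1)) at_top"
    unfolding m_def using l by (intro tendsto_intros lim lim') simp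
  also have "(of_real l * A - A) / of_real (l - 1) = A"
    using l by (simp add: field_simps)
  finally have "eventually (\<lambda>t. dist (m t) A < e / 2) at_top"
    using e2 by (rule tendstoD)
  then show "eventually (\<lambda>t. dist (s t) A < e) at_top"
    using eventually_ge_at_top[of t0]
  proof eventually_elim
    case (elim t)
    have "cmod (m t - s t) \<le> e / 2"
      unfolding m_def using elim t0 l e2 by (intro norm_diff_log_mean_le assms(1) osc) auto
    then show ?case
      using elim(1) dist_triangle2[of "s t" A "m t"]
      by (smt (verit) dist_commute dist_norm dist_triangle field_sum_of_halves)
  qed
qed

end
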